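(* Let $X$ be a real Banach space with predual $X_*$, where $X_*$ is separable or reflexive, let $Y$ be a real Hilbert space, let $K\colon X\to Y$ be a bounded dilinear mapping with unique bounded linear lifting $\breve K\colon X\times(X\otimes_{\pi,\mathrm{sym}}X)\to Y$, and let $R\colon X\to\overline{\mathbb R}$ be non-negative, proper and diconvex. Let $g^\dagger,g^\delta\in Y$ with $\|g^\dagger-g^\delta\|\le\delta$, let $\alpha>0$, and put $$J_\alpha(u):=\|K(u)-g^\delta\|^2+\alpha R(u)\qquad(u\in X).$$ Assume that (i) $J_\alpha(u)\to+\infty$ whenever $\|u\|\to+\infty$; (ii) $R$ is sequentially weakly$*$ lower semi-continuous; (iii) $K$ is sequentially weakly$*$ continuous. Let $u^\dagger$ be an $R$-minimizing solution of $K(u)=g^\dagger$, and assume the source condition $$\breve K^*\omega=(\xi^\dagger,\Xi^\dagger)\in\partial_\beta R(u^\dagger)\quad\text{for some }\omega\in Y.$$ Then every minimizer $u_\alpha^\delta$ of $J_\alpha$ satisfies $$\Delta_{\beta,(\xi^\dagger,\Xi^\dagger)}(u_\alpha^\delta,u^\dagger)\le\Bigl(\tfrac{\delta}{\sqrt\alpha}+\tfrac{\sqrt\alpha}{2}\|\omega\|\Bigr)^2 \qquad\text{and}\qquad \|K(u_\alpha^\delta)-g^\delta\|\le\delta+\alpha\|\omega\|,$$ where $\Delta_\beta$ is the dilinear Bregman distance with respect to $R$.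
   Context: $\overline{\mathbb R}=\mathbb R\cup\{\pm\infty\}$; a functional is proper if it is never $-\infty$ and not identically $+\infty$. For a real Banach space $X$, $X\otimes_\pi X$ is the (completed) projective tensor product and $X\otimes_{\pi,\mathrm{sym}}X$ is its closed subspace spanned by the tensors $u\otimes u$, $u\in X$. A mapping $K\colon X\to Y$ is dilinear if there is a linear $\breve K\colon X\times(X\otimes_{\pi,\mathrm{sym}}X)\to Y$ with $K(u)=\breve K(u,u\otimes u)$ for all $u\in X$; it is bounded if $\breve K$ is bounded, and then the bounded $\breve K$ (the lifting) is unique. $\breve K^*\colon Y\to X^*\times(X\otimes_{\pi,\mathrm{sym}}X)^*$ is the adjoint, with $Y^*$ identified with $Y$. A mapping $F\colon X\to\overline{\mathbb R}$ is diconvex if there is a proper, convex $\breve F\colon X\times(X\otimes_{\pi,\mathrm{sym}}X)\to\overline{\mathbb R}$ with $F(u)=\breve F(u,u\otimes u)$ for all $u\in X$. The dilinear subdifferential $\partial_\beta F(u)$ is the set of all $(\xi,\Xi)\in X^*\times(X\otimes_{\pi,\mathrm{sym}}X)^*$ such that $F(u)$ is finite and $F(v)\ge F(u)+\langle\xi,v-u\rangle+\langle\Xi,v\otimes v-u\otimes u\rangle$ for all $v\in X$. For $(\xi,\Xi)\in\partial_\beta F(u)$, the dilinear Bregman distance with respect to $F$ is $\Delta_{\beta,(\xi,\Xi)}(v,u):=F(v)-F(u)-\langle\xi,v-u\rangle-\langle\Xi,v\otimes v-u\otimes u\rangle$. Weak$*$ topologies on $X$ and $Y$ are those induced by the preduals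 $X_*$ and $Y_*=Y$. A point $u^\dagger\in X$ is an $R$-minimizing solution of $K(u)=g^\dagger$ if $K(u^\dagger)=g^\dagger$ and $R(u^\dagger)\le R(u)$ for all $u$ with $K(u)=g^\dagger$. *)

theory Defs
  imports "HOL-Analysis.Analysis"
begin

section \<open>The algebraic tensor product\<close>

text \<open>The list \<open>[(x\<^sub>1,y\<^sub>1), \<dots>, (x\<^sub>n,y\<^sub>n)]\<close> stands for the formal sum of the
  \<open>x\<^sub>i \<otimes> y\<^sub>i\<close> (scalars are absorbed in the first factor).  Two formal sums are the same tensor
  iff no real bilinear form distinguishes them, i.e. iff they agree modulo the bilinear relations.\<close>

definition bilin_eval :: "('a \<Rightarrow> 'b \<Rightarrow> real) \<Rightarrow> ('a \<times> 'b) list \<Rightarrow> real" where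
  "bilin_eval B xs = (\<Sum>(x, y)\<leftarrow>xs. B x y)"

definition tensor_eq :: "('a::real_vector \<times> 'b::real_vector) list \<Rightarrow> ('a \<times> 'b) list \<Rightarrow> bool" where
  "tensor_eq xs ys \<longleftrightarrow> (\<forall>B. bilinear B \<longrightarrow> bilin_eval B xs = bilin_eval B ys)"

quotient_type (overloaded) ('a, 'b) tensor = "('a::real_vector \<times> 'b::real_vector) list" / tensor_eq
  by (auto intro!: equivpI reflpI sympI transpI simp: tensor_eq_def)

lemma bilin_eval_append [simp]: "bilin_eval B (xs @ ys) = bilin_eval B xs + bilin_eval B ys"
  by (simp add: bilin_eval_def)

lemma bilin_eval_scale:
  assumes "bilinear B"
  shows "bilin_eval B (map (\<lambda>(x, y). (c *\<^sub>R x, y)) xs) = c * bilin_eval B xs"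
proof (induction xs)
  case (Cons p xs)
  then show ?case
    by (cases p) (simp add: bilin_eval_def bilinear_lmul[OF assms] algebra_simps)
qed (simp add: bilin_eval_def)

instantiation tensor :: (real_vector, real_vector) real_vector
begin

lift_definition zero_tensor :: "('a, 'b) tensor" is "[]" .

lift_definition plus_tensor :: "('a, 'b) tensor \<Rightarrow> ('a, 'b) tensor \<Rightarrow> ('a, 'b) tensor" is "(@)"
  by (simp add: tensor_eq_def)

lift_definition scaleR_tensor :: "real \<Rightarrow> ('a, 'b) tensor \<Rightarrow> ('a, 'b) tensor"
  is "\<lambda>c. map (\<lambda>(x, y). (c *\<^sub>R x, y))"
  by (simp add: tensor_eq_def bilin_eval_scale)

definition uminus_tensor :: "('a, 'b) tensor \<Rightarrow> ('a, 'b) tensor" where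
  "uminus_tensor z = (-1) *\<^sub>R z"

definition minus_tensor :: "('a, 'b) tensor \<Rightarrow> ('a, 'b) tensor \<Rightarrow> ('a, 'b) tensor" where
  "minus_tensor z w = z + (-1) *\<^sub>R w"

instance
proof
  fix a b c :: "('a, 'b) tensor" and r s :: real
  have nil [simp]: "bilin_eval B [] = 0" for B :: "'a \<Rightarrow> 'b \<Rightarrow> real"
    by (simp add: bilin_eval_def)
  have neg: "bilin_eval B (map (\<lambda>(x, y). (- x, y)) xs) = - bilin_eval B xs"
    if "bilinear B" for B :: "'a \<Rightarrow> 'b \<Rightarrow> real" and xs
    using bilin_eval_scale[OF that, of "-1" xs] by simp
  show "a + b + c = a + (b + c)" by transfer (simp add: tensor_eq_def)
  show "a + b = b + a" by transfer (simp add: tensor_eq_def)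
  show "0 + a = a" by transfer (simp add: tensor_eq_def)
  show "- a + a = 0"
    unfolding uminus_tensor_def
    by transfer (simp add: tensor_eq_def neg)
  show "a - b = a + - b" by (simp add: uminus_tensor_def minus_tensor_def)
  show "r *\<^sub>R (a + b) = r *\<^sub>R a + r *\<^sub>R b" by transfer (simp add: tensor_eq_def)
  show "(r + s) *\<^sub>R a = r *\<^sub>R a + s *\<^sub>R a"
    by transfer (simp add: tensor_eq_def bilin_eval_scale distrib_right del: scaleR_left_distrib)
  show "r *\<^sub>R s *\<^sub>R a = (r * s) *\<^sub>R a"
    by transfer (simp add: tensor_eq_def bilin_eval_scale del: map_map)
  show "1 *\<^sub>R a = a" by transfer (simp add: tensor_eq_def bilin_eval_scale)
qed

end

lift_definition alg_tensor :: "'a::real_vector \<Rightarrow> 'b::real_vector \<Rightarrow> ('a, 'b) tensor"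
  is "\<lambda>x y. [(x, y)]" .

lemma bilinear_alg_tensor: "bilinear alg_tensor"
  unfolding bilinear_def
proof safe
  fix x :: 'a
  show "linear (\<lambda>y :: 'b. alg_tensor x y)"
  proof
    fix y y' :: 'b and r :: real
    show "alg_tensor x (y + y') = alg_tensor x y + alg_tensor x y'"
      by transfer (simp add: tensor_eq_def bilin_eval_def bilinear_radd)
    show "alg_tensor x (r *\<^sub>R y) = r *\<^sub>R alg_tensor x y"
      by transfer (simp add: tensor_eq_def bilin_eval_def bilinear_rmul bilinear_lmul)
  qed
next
  fix y :: 'b
  show "linear (\<lambda>x :: 'a. alg_tensor x y)"
  proof
    fix x x' :: 'a and r :: real
    show "alg_tensor (x + x') y = alg_tensor x y + alg_tensor x' y"
      by transfer (simp add: tensor_eq_def bilin_eval_def bilinear_ladd)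
    show "alg_tensor (r *\<^sub>R x) y = r *\<^sub>R alg_tensor x y"
      by transfer (simp add: tensor_eq_def)
  qed
qed


section \<open>The projective norm\<close>

definition proj_norm :: "('a::real_normed_vector, 'b::real_normed_vector) tensor \<Rightarrow> real" where
  "proj_norm z = (INF xs\<in>{xs. z = (\<Sum>(x, y)\<leftarrow>xs. alg_tensor x y)}. \<Sum>(x, y)\<leftarrow>xs. norm x * norm y)"

lemma abs_tensor_eq: "abs_tensor xs = (\<Sum>(x, y)\<leftarrow>xs. alg_tensor x y)"
proof (induction xs)
  case (Cons p xs)
  have "abs_tensor (p # xs) = abs_tensor [p] + abs_tensor xs"
    by (simp add: plus_tensor.abs_eq)
  then show ?case
    using Cons by (cases p) (simp add: alg_tensor.abs_eq)
qed (simp add: zero_tensor_def)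

lemma tensor_rep: "\<exists>xs. z = (\<Sum>(x, y)\<leftarrow>xs. alg_tensor x y)"
  by (induct z rule: tensor.abs_induct) (auto simp: abs_tensor_eq)

lemma sum_list_norm_nonneg: "0 \<le> (\<Sum>(x, y)\<leftarrow>xs. norm x * norm y)"
  by (rule sum_list_nonneg) auto

lemma proj_norm_le:
  "z = (\<Sum>(x, y)\<leftarrow>xs. alg_tensor x y) \<Longrightarrow> proj_norm z \<le> (\<Sum>(x, y)\<leftarrow>xs. norm x * norm y)"
  unfolding proj_norm_def
  by (rule cINF_lower) (auto intro!: bdd_belowI2[where m = 0] sum_list_norm_nonneg)

lemma proj_norm_nonneg: "0 \<le> proj_norm z"
  unfolding proj_norm_def using tensor_rep
  by (intro cINF_greatest) (auto intro!: sum_list_norm_nonneg)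

lemma proj_norm_approx:
  assumes "0 < e"
  obtains xs where "z = (\<Sum>(x, y)\<leftarrow>xs. alg_tensor x y)"
    "(\<Sum>(x, y)\<leftarrow>xs. norm x * norm y) < proj_norm z + e"
proof -
  have "\<exists>xs\<in>{xs. z = (\<Sum>(x, y)\<leftarrow>xs. alg_tensor x y)}.
    (\<Sum>(x, y)\<leftarrow>xs. norm x * norm y) < proj_norm z + e"
    using assms tensor_rep[of z]
    by (subst cINF_less_iff[symmetric])
      (auto simp flip: proj_norm_def intro!: bdd_belowI2[where m = 0] sum_list_norm_nonneg)
  with that show thesis by auto
qed

lemma proj_norm_triangle: "proj_norm (z + w) \<le> proj_norm z + proj_norm w"
proof (rule field_le_epsilon)
  fix e :: real assume "0 < e"
  then have e: "0 < e / 2" by simp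
  obtain xs where xs: "z = (\<Sum>(x, y)\<leftarrow>xs. alg_tensor x y)"
    "(\<Sum>(x, y)\<leftarrow>xs. norm x * norm y) < proj_norm z + e / 2"
    using proj_norm_approx[OF e] .
  obtain ys where ys: "w = (\<Sum>(x, y)\<leftarrow>ys. alg_tensor x y)"
    "(\<Sum>(x, y)\<leftarrow>ys. norm x * norm y) < proj_norm w + e / 2"
    using proj_norm_approx[OF e] .
  have "proj_norm (z + w) \<le> (\<Sum>(x, y)\<leftarrow>xs @ ys. norm x * norm y)"
    by (rule proj_norm_le) (simp add: xs(1) ys(1))
  also have "\<dots> \<le> proj_norm z + proj_norm w + e"
    using xs(2) ys(2) by simp
  finally show "proj_norm (z + w) \<le> proj_norm z + proj_norm w + e" .
qed

lemma proj_norm_scaleR_le: "proj_norm (c *\<^sub>R z) \<le> \<bar>c\<bar> * proj_norm z"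
proof (rule field_le_epsilon)
  fix e :: real assume "0 < e"
  define d where "d = e / (\<bar>c\<bar> + 1)"
  have d: "0 < d" "\<bar>c\<bar> * d \<le> e"
    using \<open>0 < e\<close> by (auto simp: d_def field_simps)
  obtain xs where xs: "z = (\<Sum>(x, y)\<leftarrow>xs. alg_tensor x y)"
    "(\<Sum>(x, y)\<leftarrow>xs. norm x * norm y) < proj_norm z + d"
    using proj_norm_approx[OF d(1)] .
  let ?xs = "map (\<lambda>(x, y). (c *\<^sub>R x, y)) xs"
  have "z = abs_tensor xs" using xs(1) by (simp add: abs_tensor_eq)
  then have "c *\<^sub>R z = abs_tensor ?xs"
    by (simp add: scaleR_tensor.abs_eq)
  then have "proj_norm (c *\<^sub>R z) \<le> (\<Sum>(x, y)\<leftarrow>?xs. norm x * norm y)"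
    unfolding abs_tensor_eq by (rule proj_norm_le)
  also have "\<dots> = \<bar>c\<bar> * (\<Sum>(x, y)\<leftarrow>xs. norm x * norm y)"
    by (induction xs) (auto simp: algebra_simps)
  also have "\<dots> \<le> \<bar>c\<bar> * (proj_norm z + d)"
    using xs(2) by (intro mult_left_mono) auto
  also have "\<dots> \<le> \<bar>c\<bar> * proj_norm z + e"
    using d(2) by (simp add: algebra_simps)
  finally show "proj_norm (c *\<^sub>R z) \<le> \<bar>c\<bar> * proj_norm z + e" .
qed

lemma proj_norm_zero [simp]: "proj_norm (0 :: ('a::real_normed_vector, 'b::real_normed_vector) tensor) = 0"
  using proj_norm_scaleR_le[of 0 "0 :: ('a, 'b) tensor"] proj_norm_nonneg[of "0 :: ('a, 'b) tensor"]
  by simp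

lemma proj_norm_scaleR: "proj_norm (c *\<^sub>R z) = \<bar>c\<bar> * proj_norm z"
proof (cases "c = 0")
  case False
  have "\<bar>c\<bar> * proj_norm z = \<bar>c\<bar> * proj_norm ((1 / c) *\<^sub>R c *\<^sub>R z)"
    using False by simp
  also have "\<dots> \<le> \<bar>c\<bar> * (\<bar>1 / c\<bar> * proj_norm (c *\<^sub>R z))"
    by (intro mult_left_mono proj_norm_scaleR_le) auto
  also have "\<dots> = proj_norm (c *\<^sub>R z)"
    using False by simp
  finally show ?thesis using proj_norm_scaleR_le[of c z] by linarith
qed simp

lemma proj_norm_minus [simp]: "proj_norm (- z) = proj_norm z"
  using proj_norm_scaleR[of "-1" z] by simp

lemma proj_norm_minus_commute: "proj_norm (z - w) = proj_norm (w - z)"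
  using proj_norm_minus[of "z - w"] by simp

lemma proj_norm_triangle3: "proj_norm (a - c) \<le> proj_norm (a - b) + proj_norm (b - c)"
  using proj_norm_triangle[of "a - b" "b - c"] by simp

lemma proj_norm_diff_le: "\<bar>proj_norm a - proj_norm b\<bar> \<le> proj_norm (a - b)"
  using proj_norm_triangle[of "a - b" b] proj_norm_triangle[of "b - a" a]
    proj_norm_minus_commute[of a b] by auto


section \<open>The projective tensor product\<close>

text \<open>Completion of the algebraic tensor product with respect to the projective norm:
  Cauchy sequences modulo null sequences.\<close>

definition proj_cauchy :: "(nat \<Rightarrow> ('a::real_normed_vector, 'b::real_normed_vector) tensor) \<Rightarrow> bool"
  where "proj_cauchy s \<longleftrightarrow> (\<forall>e>0. \<exists>N. \<forall>m\<ge>N. \<forall>n\<ge>N. proj_norm (s m - s n) < e)"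

definition proj_eq :: "(nat \<Rightarrow> ('a::real_normed_vector, 'b::real_normed_vector) tensor) \<Rightarrow>
    (nat \<Rightarrow> ('a, 'b) tensor) \<Rightarrow> bool" where
  "proj_eq s t \<longleftrightarrow> proj_cauchy s \<and> proj_cauchy t \<and> (\<lambda>n. proj_norm (s n - t n)) \<longlonglongrightarrow> 0"

lemma proj_cauchy_const [simp]: "proj_cauchy (\<lambda>_. z)"
  by (simp add: proj_cauchy_def)

lemma proj_cauchy_dominated:
  assumes "proj_cauchy s" "proj_cauchy t" "0 \<le> C" "0 \<le> D"
    and le: "\<And>m n. proj_norm (u m - u n) \<le> C * proj_norm (s m - s n) + D * proj_norm (t m - t n)"
  shows "proj_cauchy u"
  unfolding proj_cauchy_def
proof safe
  fix e :: real assume "0 < e"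
  define d where "d = e / (C + D + 1)"
  have d: "0 < d" "C * d + D * d < e"
    using \<open>0 < e\<close> assms(3,4) by (auto simp: d_def field_simps add_pos_nonneg)
  obtain M where M: "\<And>m n. m \<ge> M \<Longrightarrow> n \<ge> M \<Longrightarrow> proj_norm (s m - s n) < d"
    using assms(1) d(1) unfolding proj_cauchy_def by meson
  obtain N where N: "\<And>m n. m \<ge> N \<Longrightarrow> n \<ge> N \<Longrightarrow> proj_norm (t m - t n) < d"
    using assms(2) d(1) unfolding proj_cauchy_def by meson
  have "proj_norm (u m - u n) < e" if "m \<ge> max M N" "n \<ge> max M N" for m n
  proof -
    have "proj_norm (u m - u n) \<le> C * d + D * d"
      using le[of m n] M[of m n] N[of m n] that assms(3,4)
      by (smt (verit) max.bounded_iff mult_left_mono)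
    with d(2) show ?thesis by simp
  qed
  then show "\<exists>N. \<forall>m\<ge>N. \<forall>n\<ge>N. proj_norm (u m - u n) < e" by blast
qed

lemma proj_cauchy_add: "proj_cauchy s \<Longrightarrow> proj_cauchy t \<Longrightarrow> proj_cauchy (\<lambda>n. s n + t n)"
  by (rule proj_cauchy_dominated[of s t 1 1])
    (auto simp: add_diff_add intro: proj_norm_triangle)

lemma proj_cauchy_scaleR: "proj_cauchy s \<Longrightarrow> proj_cauchy (\<lambda>n. c *\<^sub>R s n)"
  by (rule proj_cauchy_dominated[of s s "\<bar>c\<bar>" 0])
    (auto simp: proj_norm_scaleR simp flip: scaleR_diff_right)

lemma proj_null_dominated:
  assumes "(\<lambda>n. proj_norm (s n)) \<longlonglongrightarrow> 0" "(\<lambda>n. proj_norm (t n)) \<longlonglongrightarrow> 0"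
    and "\<And>n. proj_norm (u n) \<le> C * proj_norm (s n) + D * proj_norm (t n)"
  shows "(\<lambda>n. proj_norm (u n)) \<longlonglongrightarrow> 0"
proof (rule tendsto_sandwich[OF _ _ tendsto_const])
  show "(\<lambda>n. C * proj_norm (s n) + D * proj_norm (t n)) \<longlonglongrightarrow> 0"
    using tendsto_add[OF tendsto_mult_left[OF assms(1), of C] tendsto_mult_left[OF assms(2), of D]]
    by simp
qed (use assms(3) in \<open>auto intro!: always_eventually proj_norm_nonneg\<close>)

quotient_type (overloaded) ('a, 'b) proj_tensor =
  "nat \<Rightarrow> ('a::real_normed_vector, 'b::real_normed_vector) tensor" / partial: proj_eq
proof (rule part_equivpI)
  show "\<exists>s. proj_eq s (s :: nat \<Rightarrow> ('a, 'b) tensor)"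
    by (rule exI[of _ "\<lambda>_. 0"]) (simp add: proj_eq_def)
  show "symp (proj_eq :: (nat \<Rightarrow> ('a, 'b) tensor) \<Rightarrow> _)"
  proof (rule sympI)
    fix s t :: "nat \<Rightarrow> ('a, 'b) tensor"
    have "(\<lambda>n. proj_norm (s n - t n)) = (\<lambda>n. proj_norm (t n - s n))"
      by (rule ext) (rule proj_norm_minus_commute)
    then show "proj_eq s t \<Longrightarrow> proj_eq t s" by (simp add: proj_eq_def)
  qed
  show "transp (proj_eq :: (nat \<Rightarrow> ('a, 'b) tensor) \<Rightarrow> _)"
  proof (rule transpI)
    fix s t u :: "nat \<Rightarrow> ('a, 'b) tensor"
    assume st: "proj_eq s t" and tu: "proj_eq t u"
    have "(\<lambda>n. proj_norm (s n - u n)) \<longlonglongrightarrow> 0"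
      by (rule proj_null_dominated[of "\<lambda>n. s n - t n" "\<lambda>n. t n - u n" _ 1 1])
        (use st tu in \<open>simp_all add: proj_eq_def proj_norm_triangle3\<close>)
    with st tu show "proj_eq s u" by (simp add: proj_eq_def)
  qed
qed

lemma proj_eq_refl: "proj_eq s s \<longleftrightarrow> proj_cauchy s"
  by (simp add: proj_eq_def)

lemma proj_cauchy_convergent:
  assumes "proj_cauchy s"
  shows "convergent (\<lambda>n. proj_norm (s n))"
proof -
  have "Cauchy (\<lambda>n. proj_norm (s n))"
  proof (rule CauchyI)
    fix e :: real assume "0 < e"
    then obtain N where "\<forall>m\<ge>N. \<forall>n\<ge>N. proj_norm (s m - s n) < e"
      using assms unfolding proj_cauchy_def by blast
    then have "norm (proj_norm (s m) - proj_norm (s n)) < e" if "m \<ge> N" "n \<ge> N" for m n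
      using proj_norm_diff_le[of "s m" "s n"] that unfolding real_norm_def
      by (meson order_le_less_trans)
    then show "\<exists>N. \<forall>m\<ge>N. \<forall>n\<ge>N. norm (proj_norm (s m) - proj_norm (s n)) < e"
      by blast
  qed
  then show ?thesis by (simp add: Cauchy_convergent_iff)
qed

instantiation proj_tensor :: (real_normed_vector, real_normed_vector) real_normed_vector
begin

lift_definition zero_proj_tensor :: "('a, 'b) proj_tensor" is "\<lambda>_. 0"
  by (simp add: proj_eq_def)

lift_definition plus_proj_tensor ::
  "('a, 'b) proj_tensor \<Rightarrow> ('a, 'b) proj_tensor \<Rightarrow> ('a, 'b) proj_tensor" is "\<lambda>s t n. s n + t n"
proof -
  fix s s' t t' :: "nat \<Rightarrow> ('a, 'b) tensor"
  assume "proj_eq s s'" "proj_eq t t'"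
  then show "proj_eq (\<lambda>n. s n + t n) (\<lambda>n. s' n + t' n)"
    unfolding proj_eq_def
    by (auto intro: proj_cauchy_add)
      (rule proj_null_dominated[of "\<lambda>n. s n - s' n" "\<lambda>n. t n - t' n" _ 1 1],
        auto simp: add_diff_add intro: proj_norm_triangle)
qed

lift_definition scaleR_proj_tensor :: "real \<Rightarrow> ('a, 'b) proj_tensor \<Rightarrow> ('a, 'b) proj_tensor"
  is "\<lambda>c s n. c *\<^sub>R s n"
proof -
  fix c and s s' :: "nat \<Rightarrow> ('a, 'b) tensor"
  assume "proj_eq s s'"
  then show "proj_eq (\<lambda>n. c *\<^sub>R s n) (\<lambda>n. c *\<^sub>R s' n)"
    unfolding proj_eq_def
    by (auto intro: proj_cauchy_scaleR tendsto_mult_right_zero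
        simp: proj_norm_scaleR simp flip: scaleR_diff_right)
qed

definition uminus_proj_tensor :: "('a, 'b) proj_tensor \<Rightarrow> ('a, 'b) proj_tensor" where
  "uminus_proj_tensor z = (-1) *\<^sub>R z"

definition minus_proj_tensor ::
  "('a, 'b) proj_tensor \<Rightarrow> ('a, 'b) proj_tensor \<Rightarrow> ('a, 'b) proj_tensor" where
  "minus_proj_tensor z w = z + (-1) *\<^sub>R w"

lift_definition norm_proj_tensor :: "('a, 'b) proj_tensor \<Rightarrow> real"
  is "\<lambda>s. lim (\<lambda>n. proj_norm (s n))"
proof -
  fix s t :: "nat \<Rightarrow> ('a, 'b) tensor"
  assume st: "proj_eq s t"
  have "(\<lambda>n. proj_norm (s n) - proj_norm (t n)) \<longlonglongrightarrow> 0"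
    by (rule Lim_null_comparison[of _ "\<lambda>n. proj_norm (s n - t n)"])
      (use st in \<open>auto simp: proj_eq_def proj_norm_diff_le\<close>)
  moreover obtain l where l: "(\<lambda>n. proj_norm (t n)) \<longlonglongrightarrow> l"
    using st proj_cauchy_convergent by (auto simp: proj_eq_def convergent_def)
  ultimately have "(\<lambda>n. proj_norm (s n)) \<longlonglongrightarrow> l"
    using tendsto_add by fastforce
  with l show "lim (\<lambda>n. proj_norm (s n)) = lim (\<lambda>n. proj_norm (t n))"
    by (simp add: limI)
qed

definition dist_proj_tensor :: "('a, 'b) proj_tensor \<Rightarrow> ('a, 'b) proj_tensor \<Rightarrow> real" where
  "dist_proj_tensor z w = norm (z - w)"

definition sgn_proj_tensor :: "('a, 'b) proj_tensor \<Rightarrow> ('a, 'b) proj_tensor" where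
  "sgn_proj_tensor z = inverse (norm z) *\<^sub>R z"

definition uniformity_proj_tensor :: "(('a, 'b) proj_tensor \<times> ('a, 'b) proj_tensor) filter" where
  "uniformity_proj_tensor = (INF e\<in>{0<..}. principal {(z, w). dist z w < e})"

definition open_proj_tensor :: "('a, 'b) proj_tensor set \<Rightarrow> bool" where
  "open_proj_tensor U \<longleftrightarrow> (\<forall>z\<in>U. \<forall>\<^sub>F (z', w) in uniformity. z' = z \<longrightarrow> w \<in> U)"

instance
proof
  fix a b c :: "('a, 'b) proj_tensor" and r s :: real
  show "a + b + c = a + (b + c)"
    by transfer (simp add: add.assoc proj_eq_refl proj_cauchy_add)
  show "a + b = b + a"
    by transfer (simp add: add.commute proj_eq_refl proj_cauchy_add)
  show "0 + a = a" by transfer simp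
  show "- a + a = 0"
    unfolding uminus_proj_tensor_def by transfer (simp add: proj_eq_refl)
  show "a - b = a + - b" by (simp add: uminus_proj_tensor_def minus_proj_tensor_def)
  show "r *\<^sub>R (a + b) = r *\<^sub>R a + r *\<^sub>R b"
    by transfer (simp add: scaleR_add_right proj_eq_refl proj_cauchy_add proj_cauchy_scaleR)
  show "(r + s) *\<^sub>R a = r *\<^sub>R a + s *\<^sub>R a"
    by transfer (simp add: scaleR_add_left proj_eq_refl proj_cauchy_add proj_cauchy_scaleR)
  show "r *\<^sub>R s *\<^sub>R a = (r * s) *\<^sub>R a"
    by transfer (simp add: proj_eq_refl proj_cauchy_scaleR)
  show "1 *\<^sub>R a = a" by transfer simp
  show "dist a b = norm (a - b)" by (rule dist_proj_tensor_def)
  show "sgn a = inverse (norm a) *\<^sub>R a" by (rule sgn_proj_tensor_def)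
  show "(norm a = 0) = (a = 0)"
  proof transfer
    fix s :: "nat \<Rightarrow> ('a, 'b) tensor" assume "proj_eq s s"
    then have s: "proj_cauchy s" by (simp add: proj_eq_refl)
    then have "(\<lambda>n. proj_norm (s n)) \<longlonglongrightarrow> lim (\<lambda>n. proj_norm (s n))"
      using proj_cauchy_convergent convergent_LIMSEQ_iff by blast
    then have "(lim (\<lambda>n. proj_norm (s n)) = 0) = ((\<lambda>n. proj_norm (s n)) \<longlonglongrightarrow> 0)"
      by (metis limI)
    also have "\<dots> = proj_eq s (\<lambda>_. 0)"
      using s by (simp add: proj_eq_def)
    finally show "(lim (\<lambda>n. proj_norm (s n)) = 0) = proj_eq s (\<lambda>_. 0)" .
  qed
  show "norm (a + b) \<le> norm a + norm b"
  proof transfer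
    fix s t :: "nat \<Rightarrow> ('a, 'b) tensor" assume "proj_eq s s" "proj_eq t t"
    then have "proj_cauchy s" "proj_cauchy t" by (simp_all add: proj_eq_refl)
    then have "(\<lambda>n. proj_norm (s n)) \<longlonglongrightarrow> lim (\<lambda>n. proj_norm (s n))"
      "(\<lambda>n. proj_norm (t n)) \<longlonglongrightarrow> lim (\<lambda>n. proj_norm (t n))"
      "(\<lambda>n. proj_norm (s n + t n)) \<longlonglongrightarrow> lim (\<lambda>n. proj_norm (s n + t n))"
      using proj_cauchy_convergent proj_cauchy_add convergent_LIMSEQ_iff by blast+
    then show "lim (\<lambda>n. proj_norm (s n + t n)) \<le>
      lim (\<lambda>n. proj_norm (s n)) + lim (\<lambda>n. proj_norm (t n))"
      by (intro LIMSEQ_le[OF _ tendsto_add]) (auto intro: proj_norm_triangle)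
  qed
  show "norm (r *\<^sub>R a) = \<bar>r\<bar> * norm a"
  proof transfer
    fix r and s :: "nat \<Rightarrow> ('a, 'b) tensor" assume "proj_eq s s"
    then have "(\<lambda>n. proj_norm (s n)) \<longlonglongrightarrow> lim (\<lambda>n. proj_norm (s n))"
      using proj_cauchy_convergent convergent_LIMSEQ_iff proj_eq_refl by blast
    then show "lim (\<lambda>n. proj_norm (r *\<^sub>R s n)) = \<bar>r\<bar> * lim (\<lambda>n. proj_norm (s n))"
      by (intro limI) (auto simp: proj_norm_scaleR intro: tendsto_mult_left)
  qed
  show "uniformity = (INF e\<in>{0<..}. principal {(z :: ('a, 'b) proj_tensor, w). dist z w < e})"
    by (rule uniformity_proj_tensor_def)
  show "open U \<longleftrightarrow> (\<forall>z\<in>U. \<forall>\<^sub>F (z', w) in uniformity. z' = z \<longrightarrow> w \<in> U)"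
    for U :: "('a, 'b) proj_tensor set"
    by (rule open_proj_tensor_def)
qed

end

definition proj_of_tensor ::
  "('a::real_normed_vector, 'b::real_normed_vector) tensor \<Rightarrow> ('a, 'b) proj_tensor" where
  "proj_of_tensor z = abs_proj_tensor (\<lambda>_. z)"

lemma norm_proj_of_tensor: "norm (proj_of_tensor z) = proj_norm z"
  by (simp add: proj_of_tensor_def norm_proj_tensor.abs_eq proj_eq_refl)

lemma linear_proj_of_tensor: "linear proj_of_tensor"
  by unfold_locales
    (simp_all add: proj_of_tensor_def plus_proj_tensor.abs_eq scaleR_proj_tensor.abs_eq proj_eq_refl)

lemma proj_of_tensor_diff: "proj_of_tensor (z - w) = proj_of_tensor z - proj_of_tensor w"
  by (rule linear_diff[OF linear_proj_of_tensor])

lemma abs_proj_tensor_diff: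
  assumes "proj_cauchy s" "proj_cauchy t"
  shows "abs_proj_tensor s - abs_proj_tensor t = abs_proj_tensor (\<lambda>n. s n - t n)"
proof -
  have "abs_proj_tensor s - abs_proj_tensor t = abs_proj_tensor (\<lambda>n. s n + (-1) *\<^sub>R t n)"
    unfolding minus_proj_tensor_def using assms proj_cauchy_scaleR[OF assms(2), of "-1"]
    by (simp only: plus_proj_tensor.abs_eq scaleR_proj_tensor.abs_eq proj_eq_refl)
  then show ?thesis by simp
qed

lemma proj_of_tensor_dense:
  assumes "0 < e"
  shows "\<exists>z. dist w (proj_of_tensor z) < e"
proof -
  obtain s where s: "proj_cauchy s" "w = abs_proj_tensor s"
    using Quotient_rep_reflp[OF Quotient_proj_tensor] Quotient_abs_rep[OF Quotient_proj_tensor]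
    by (metis proj_eq_refl)
  obtain N where N: "\<And>m n. m \<ge> N \<Longrightarrow> n \<ge> N \<Longrightarrow> proj_norm (s m - s n) < e / 2"
    using s(1) assms unfolding proj_cauchy_def by (meson half_gt_zero)
  have c: "proj_cauchy (\<lambda>n. s n - s N)"
    using proj_cauchy_add[OF s(1), of "\<lambda>_. - s N"] by simp
  have "w - proj_of_tensor (s N) = abs_proj_tensor (\<lambda>n. s n - s N)"
    unfolding s(2) proj_of_tensor_def by (intro abs_proj_tensor_diff s(1) proj_cauchy_const)
  then have "dist w (proj_of_tensor (s N)) = lim (\<lambda>n. proj_norm (s n - s N))"
    using c by (simp add: dist_norm norm_proj_tensor.abs_eq proj_eq_refl)
  also have "\<dots> \<le> e / 2"
  proof (rule LIMSEQ_le_const2)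
    show "(\<lambda>n. proj_norm (s n - s N)) \<longlonglongrightarrow> lim (\<lambda>n. proj_norm (s n - s N))"
      using c proj_cauchy_convergent convergent_LIMSEQ_iff by blast
    show "\<exists>M. \<forall>n\<ge>M. proj_norm (s n - s N) \<le> e / 2"
      using N by (meson less_imp_le order_refl)
  qed
  finally show ?thesis using assms by (intro exI[of _ "s N"]) simp
qed

instance proj_tensor :: (real_normed_vector, real_normed_vector) banach
proof
  fix X :: "nat \<Rightarrow> ('a, 'b) proj_tensor"
  assume X: "Cauchy X"
  have "\<exists>z. dist (X n) (proj_of_tensor z) < inverse (real (Suc n))" for n
    by (rule proj_of_tensor_dense) simp
  then obtain t where t: "\<And>n. dist (X n) (proj_of_tensor (t n)) < inverse (real (Suc n))"
    by metis
  have "(\<lambda>n. dist (X n) (proj_of_tensor (t n))) \<longlonglongrightarrow> 0"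
    by (rule tendsto_sandwich[OF _ _ tendsto_const LIMSEQ_inverse_real_of_nat])
      (rule always_eventually; rule allI; rule zero_le_dist less_imp_le[OF t])+
  then have d0: "(\<lambda>n. X n - proj_of_tensor (t n)) \<longlonglongrightarrow> 0"
    by (simp add: tendsto_norm_zero_iff dist_norm)
  have "Cauchy (\<lambda>n. proj_of_tensor (t n))"
  proof (rule metric_CauchyI)
    fix e :: real assume "0 < e"
    then have e: "0 < e / 3" by simp
    obtain M where M: "\<And>m n. m \<ge> M \<Longrightarrow> n \<ge> M \<Longrightarrow> dist (X m) (X n) < e / 3"
      using metric_CauchyD[OF X e] by blast
    obtain N where N: "\<And>n. n \<ge> N \<Longrightarrow> dist (X n) (proj_of_tensor (t n)) < e / 3"
      using LIMSEQ_D[OF d0 e] by (auto simp: dist_norm)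
    have "dist (proj_of_tensor (t m)) (proj_of_tensor (t n)) < e"
      if "m \<ge> max M N" "n \<ge> max M N" for m n
    proof -
      have "dist (proj_of_tensor (t m)) (proj_of_tensor (t n)) \<le>
          dist (X m) (proj_of_tensor (t m)) + dist (X m) (X n) + dist (X n) (proj_of_tensor (t n))"
        by metric
      also have "\<dots> < e"
        using M[of m n] N[of m] N[of n] that by simp
      finally show ?thesis .
    qed
    then show "\<exists>N. \<forall>m\<ge>N. \<forall>n\<ge>N. dist (proj_of_tensor (t m)) (proj_of_tensor (t n)) < e"
      by blast
  qed
  then have t_cauchy: "proj_cauchy t"
    unfolding proj_cauchy_def Cauchy_iff
    by (simp add: norm_proj_of_tensor flip: proj_of_tensor_diff)
  define l where "l = abs_proj_tensor t"
  have lim_l: "(\<lambda>n. proj_of_tensor (t n)) \<longlonglongrightarrow> l"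
  proof (rule metric_LIMSEQ_I)
    fix e :: real assume "0 < e"
    then obtain N where N: "\<And>m n. m \<ge> N \<Longrightarrow> n \<ge> N \<Longrightarrow> proj_norm (t m - t n) < e / 2"
      using t_cauchy unfolding proj_cauchy_def by (meson half_gt_zero)
    have "dist (proj_of_tensor (t n)) l < e" if "n \<ge> N" for n
    proof -
      have c: "proj_cauchy (\<lambda>m. t m - t n)"
        using proj_cauchy_add[OF t_cauchy, of "\<lambda>_. - t n"] by simp
      have "l - proj_of_tensor (t n) = abs_proj_tensor (\<lambda>m. t m - t n)"
        unfolding l_def proj_of_tensor_def
        by (intro abs_proj_tensor_diff t_cauchy proj_cauchy_const)
      then have "dist l (proj_of_tensor (t n)) = lim (\<lambda>m. proj_norm (t m - t n))"
        using c by (simp add: dist_norm norm_proj_tensor.abs_eq proj_eq_refl)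
      also have "\<dots> \<le> e / 2"
      proof (rule LIMSEQ_le_const2)
        show "(\<lambda>m. proj_norm (t m - t n)) \<longlonglongrightarrow> lim (\<lambda>m. proj_norm (t m - t n))"
          using c proj_cauchy_convergent convergent_LIMSEQ_iff by blast
        show "\<exists>M. \<forall>m\<ge>M. proj_norm (t m - t n) \<le> e / 2"
          using N that by (meson less_imp_le)
      qed
      finally show ?thesis using \<open>0 < e\<close> by (simp add: dist_commute)
    qed
    then show "\<exists>N. \<forall>n\<ge>N. dist (proj_of_tensor (t n)) l < e" by blast
  qed
  have "X \<longlonglongrightarrow> l"
    using tendsto_add[OF d0 lim_l] by simp
  then show "convergent X" by (auto simp: convergent_def)
qed

definition proj_tensor :: "'a::real_normed_vector \<Rightarrow> 'b::real_normed_vector \<Rightarrow> ('a, 'b) proj_tensor"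
    (infixr \<open>\<otimes>\<^sub>\<pi>\<close> 75) where
  "x \<otimes>\<^sub>\<pi> y = proj_of_tensor (alg_tensor x y)"


section \<open>The symmetric projective tensor product\<close>

definition sym_tensors :: "('a::real_normed_vector, 'a) proj_tensor set" where
  "sym_tensors = closure (span (range (\<lambda>u. u \<otimes>\<^sub>\<pi> u)))"

lemma subspace_sym_tensors: "subspace (sym_tensors :: ('a::real_normed_vector, 'a) proj_tensor set)"
  unfolding subspace_def
proof safe
  let ?S = "span (range (\<lambda>u :: 'a. u \<otimes>\<^sub>\<pi> u))"
  show "0 \<in> sym_tensors"
    unfolding sym_tensors_def using closure_subset span_zero by blast
  fix z w :: "('a, 'a) proj_tensor" and c :: real
  assume "z \<in> sym_tensors"
  then obtain s where s: "\<And>n. s n \<in> ?S" "s \<longlonglongrightarrow> z"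
    unfolding sym_tensors_def closure_sequential by blast
  have "\<And>n. c *\<^sub>R s n \<in> ?S" "(\<lambda>n. c *\<^sub>R s n) \<longlonglongrightarrow> c *\<^sub>R z"
    using s by (auto intro: span_scale tendsto_intros)
  then show "c *\<^sub>R z \<in> sym_tensors"
    unfolding sym_tensors_def closure_sequential by (intro exI[of _ "\<lambda>n. c *\<^sub>R s n"]) simp
  assume "w \<in> sym_tensors"
  then obtain t where t: "\<And>n. t n \<in> ?S" "t \<longlonglongrightarrow> w"
    unfolding sym_tensors_def closure_sequential by blast
  have "\<And>n. s n + t n \<in> ?S" "(\<lambda>n. s n + t n) \<longlonglongrightarrow> z + w"
    using s t by (auto intro: span_add tendsto_intros)
  then show "z + w \<in> sym_tensors"
    unfolding sym_tensors_def closure_sequential by (intro exI[of _ "\<lambda>n. s n + t n"]) simp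
qed

typedef (overloaded) 'a sym_tensor = "sym_tensors :: ('a::real_normed_vector, 'a) proj_tensor set"
  using subspace_0[OF subspace_sym_tensors] by blast

setup_lifting type_definition_sym_tensor

instantiation sym_tensor :: (real_normed_vector) real_normed_vector
begin

lift_definition zero_sym_tensor :: "'a sym_tensor" is 0
  by (rule subspace_0[OF subspace_sym_tensors])

lift_definition plus_sym_tensor :: "'a sym_tensor \<Rightarrow> 'a sym_tensor \<Rightarrow> 'a sym_tensor" is "(+)"
  by (rule subspace_add[OF subspace_sym_tensors])

lift_definition minus_sym_tensor :: "'a sym_tensor \<Rightarrow> 'a sym_tensor \<Rightarrow> 'a sym_tensor" is "(-)"
  by (rule subspace_diff[OF subspace_sym_tensors])

lift_definition uminus_sym_tensor :: "'a sym_tensor \<Rightarrow> 'a sym_tensor" is uminus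
  by (rule subspace_neg[OF subspace_sym_tensors])

lift_definition scaleR_sym_tensor :: "real \<Rightarrow> 'a sym_tensor \<Rightarrow> 'a sym_tensor" is scaleR
  by (rule subspace_scale[OF subspace_sym_tensors])

lift_definition norm_sym_tensor :: "'a sym_tensor \<Rightarrow> real" is norm .

definition dist_sym_tensor :: "'a sym_tensor \<Rightarrow> 'a sym_tensor \<Rightarrow> real" where
  "dist_sym_tensor z w = norm (z - w)"

definition sgn_sym_tensor :: "'a sym_tensor \<Rightarrow> 'a sym_tensor" where
  "sgn_sym_tensor z = inverse (norm z) *\<^sub>R z"

definition uniformity_sym_tensor :: "('a sym_tensor \<times> 'a sym_tensor) filter" where
  "uniformity_sym_tensor = (INF e\<in>{0<..}. principal {(z, w). dist z w < e})"

definition open_sym_tensor :: "'a sym_tensor set \<Rightarrow> bool" where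
  "open_sym_tensor U \<longleftrightarrow> (\<forall>z\<in>U. \<forall>\<^sub>F (z', w) in uniformity. z' = z \<longrightarrow> w \<in> U)"

instance
proof
  fix a b c :: "'a sym_tensor" and r s :: real
  show "a + b + c = a + (b + c)" by transfer simp
  show "a + b = b + a" by transfer simp
  show "0 + a = a" by transfer simp
  show "- a + a = 0" by transfer simp
  show "a - b = a + - b" by transfer simp
  show "r *\<^sub>R (a + b) = r *\<^sub>R a + r *\<^sub>R b" by transfer (simp add: scaleR_add_right)
  show "(r + s) *\<^sub>R a = r *\<^sub>R a + s *\<^sub>R a" by transfer (simp add: scaleR_add_left)
  show "r *\<^sub>R s *\<^sub>R a = (r * s) *\<^sub>R a" by transfer simp
  show "1 *\<^sub>R a = a" by transfer simp
  show "dist a b = norm (a - b)" by (rule dist_sym_tensor_def)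
  show "sgn a = inverse (norm a) *\<^sub>R a" by (rule sgn_sym_tensor_def)
  show "(norm a = 0) = (a = 0)" by transfer simp
  show "norm (a + b) \<le> norm a + norm b" by transfer (rule norm_triangle_ineq)
  show "norm (r *\<^sub>R a) = \<bar>r\<bar> * norm a" by transfer simp
  show "uniformity = (INF e\<in>{0<..}. principal {(z :: 'a sym_tensor, w). dist z w < e})"
    by (rule uniformity_sym_tensor_def)
  show "open U \<longleftrightarrow> (\<forall>z\<in>U. \<forall>\<^sub>F (z', w) in uniformity. z' = z \<longrightarrow> w \<in> U)"
    for U :: "'a sym_tensor set"
    by (rule open_sym_tensor_def)
qed

end

instance sym_tensor :: (real_normed_vector) banach
proof
  fix X :: "nat \<Rightarrow> 'a sym_tensor"
  assume X: "Cauchy X"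
  have dist_Rep: "dist (Rep_sym_tensor z) (Rep_sym_tensor w) = dist z w" for z w :: "'a sym_tensor"
    unfolding dist_norm by transfer simp
  have "Cauchy (\<lambda>n. Rep_sym_tensor (X n))"
    using X unfolding Cauchy_def dist_Rep .
  then obtain l where l: "(\<lambda>n. Rep_sym_tensor (X n)) \<longlonglongrightarrow> l"
    using Cauchy_convergent_iff convergent_def by blast
  have "closed (sym_tensors :: ('a, 'a) proj_tensor set)"
    by (simp add: sym_tensors_def)
  then have "l \<in> sym_tensors"
    using l Rep_sym_tensor by (metis closed_sequentially)
  then obtain w where w: "l = Rep_sym_tensor w"
    by (metis Rep_sym_tensor_cases)
  have "X \<longlonglongrightarrow> w"
    using l unfolding lim_sequentially w dist_Rep .
  then show "convergent X" by (auto simp: convergent_def)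
qed

lift_definition tensor_square :: "'a::real_normed_vector \<Rightarrow> 'a sym_tensor" is "\<lambda>u. u \<otimes>\<^sub>\<pi> u"
  unfolding sym_tensors_def by (meson closure_subset rangeI span_base subsetD)

lemma tensor_square_minus: "tensor_square (- u) = tensor_square u"
  by transfer
    (simp add: proj_tensor_def bilinear_lneg[OF bilinear_alg_tensor] bilinear_rneg[OF bilinear_alg_tensor])

lemma closure_span_tensor_square:
  "closure (span (range tensor_square)) = (UNIV :: 'a::real_normed_vector sym_tensor set)"
proof -
  let ?S = "span (range (tensor_square :: 'a \<Rightarrow> 'a sym_tensor))"
  have Rep_linear: "linear (Rep_sym_tensor :: 'a sym_tensor \<Rightarrow> _)"
    by (rule linearI) (transfer; simp)+
  have "range (\<lambda>u :: 'a. u \<otimes>\<^sub>\<pi> u) = Rep_sym_tensor ` range tensor_square"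
    by (simp add: image_image tensor_square.rep_eq)
  then have S: "span (range (\<lambda>u :: 'a. u \<otimes>\<^sub>\<pi> u)) = Rep_sym_tensor ` ?S"
    by (simp add: linear_span_image[OF Rep_linear])
  have "z \<in> closure ?S" for z :: "'a sym_tensor"
  proof -
    have "Rep_sym_tensor z \<in> closure (Rep_sym_tensor ` ?S)"
      using Rep_sym_tensor[of z] unfolding sym_tensors_def S .
    moreover have "dist (Rep_sym_tensor w) (Rep_sym_tensor z) = dist w z" for w :: "'a sym_tensor"
      unfolding dist_norm by transfer simp
    ultimately show ?thesis by (simp add: closure_approachable)
  qed
  then show ?thesis by blast
qed


section \<open>Preduals and weak* convergence\<close>

text \<open>A predual of \<open>'x\<close> is a Banach space \<open>'p\<close> with an isometric isomorphism from \<open>'x\<close> onto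
  the dual of \<open>'p\<close>.\<close>

definition is_predual :: "('x::banach \<Rightarrow> ('p::banach \<Rightarrow>\<^sub>L real)) \<Rightarrow> bool" where
  "is_predual \<iota> \<longleftrightarrow> linear \<iota> \<and> (\<forall>x. norm (\<iota> x) = norm x) \<and> surj \<iota>"

definition reflexive_space :: "'p::real_normed_vector itself \<Rightarrow> bool" where
  "reflexive_space _ \<longleftrightarrow>
    (\<forall>\<phi> :: ('p \<Rightarrow>\<^sub>L real) \<Rightarrow>\<^sub>L real. \<exists>p. \<forall>f. blinfun_apply \<phi> f = blinfun_apply f p)"

definition weakstar_tendsto ::
  "('x \<Rightarrow> ('p::real_normed_vector \<Rightarrow>\<^sub>L real)) \<Rightarrow> (nat \<Rightarrow> 'x) \<Rightarrow> 'x \<Rightarrow> bool" where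
  "weakstar_tendsto \<iota> s u \<longleftrightarrow> (\<forall>p. (\<lambda>n. \<iota> (s n) p) \<longlonglongrightarrow> \<iota> u p)"

definition seq_weakstar_lsc ::
  "('x \<Rightarrow> ('p::real_normed_vector \<Rightarrow>\<^sub>L real)) \<Rightarrow> ('x \<Rightarrow> ereal) \<Rightarrow> bool" where
  "seq_weakstar_lsc \<iota> F \<longleftrightarrow>
    (\<forall>s u. weakstar_tendsto \<iota> s u \<longrightarrow> F u \<le> liminf (\<lambda>n. F (s n)))"

definition seq_weakstar_continuous ::
  "('x \<Rightarrow> ('p::real_normed_vector \<Rightarrow>\<^sub>L real)) \<Rightarrow> ('y \<Rightarrow> ('q::real_normed_vector \<Rightarrow>\<^sub>L real)) \<Rightarrow>
    ('x \<Rightarrow> 'y) \<Rightarrow> bool" where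
  "seq_weakstar_continuous \<iota> \<kappa> K \<longleftrightarrow>
    (\<forall>s u. weakstar_tendsto \<iota> s u \<longrightarrow> weakstar_tendsto \<kappa> (\<lambda>n. K (s n)) (K u))"


section \<open>Dilinear mappings\<close>

definition bounded_lifting ::
  "('x::real_normed_vector \<Rightarrow> 'y::real_normed_vector) \<Rightarrow> (('x \<times> 'x sym_tensor) \<Rightarrow>\<^sub>L 'y) \<Rightarrow> bool" where
  "bounded_lifting K L \<longleftrightarrow> (\<forall>u. K u = L (u, tensor_square u))"

definition bounded_dilinear :: "('x::real_normed_vector \<Rightarrow> 'y::real_normed_vector) \<Rightarrow> bool" where
  "bounded_dilinear K \<longleftrightarrow> (\<exists>L. bounded_lifting K L)"

lemma bounded_lifting_unique:
  fixes L L' :: "('x::real_normed_vector \<times> 'x sym_tensor) \<Rightarrow>\<^sub>L 'y::real_normed_vector"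
  assumes "bounded_lifting K L" "bounded_lifting K L'"
  shows "L = L'"
proof -
  define D where "D = L - L'"
  have D0: "D (u, tensor_square u) = 0" for u
    using assms by (simp add: D_def bounded_lifting_def blinfun.diff_left)
  have split: "D (u, z) = D (u, 0) + D (0, z)" for u z
    by (simp flip: blinfun.add_right)
  have neg: "D (- u, 0) = - D (u, 0)" for u
    by (simp flip: blinfun.minus_right)
  have "D (u, 0) + D (0, tensor_square u) = 0" "- D (u, 0) + D (0, tensor_square u) = 0" for u
    using D0[of u] D0[of "- u"] split[of u "tensor_square u"] split[of "- u" "tensor_square u"]
    by (simp_all add: tensor_square_minus neg)
  then have sq: "D (0, tensor_square u) = 0" and fst0: "D (u, 0) = 0" for u
    by (metis add.right_neutral add_eq_0_iff double_zero minus_add_cancel neg_eq_iff_add_eq_0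
        scaleR_2 scaleR_eq_0_iff zero_neq_numeral)+
  have lin: "bounded_linear (\<lambda>z. D (0, z))"
    by (intro bounded_linear_intros)
  have "D (0, z) = 0" if "z \<in> span (range tensor_square)" for z
    by (rule linear_eq_0_on_span[OF bounded_linear.linear[OF lin] _ that]) (auto simp: sq)
  moreover have "closed {z. D (0, z) = 0}"
    by (intro closed_Collect_eq continuous_on_const
        linear_continuous_on[OF lin])
  ultimately have "closure (span (range tensor_square)) \<subseteq> {z. D (0, z) = 0}"
    by (intro closure_minimal) auto
  then have "D (0, z) = 0" for z
    unfolding closure_span_tensor_square by blast
  with fst0 split have "D = 0"
    by (intro blinfun_eqI) (metis add.right_neutral blinfun.zero_left surj_pair)
  then show ?thesis by (simp add: D_def)
qed

text \<open>The adjoint \<open>Y \<rightarrow> A\<^sup>* \<times> B\<^sup>*\<close> of a bounded linear map \<open>A \<times> B \<rightarrow> Y\<close>, with the Hilbert space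
  \<open>Y\<close> identified with its dual and \<open>(A \<times> B)\<^sup>*\<close> with \<open>A\<^sup>* \<times> B\<^sup>*\<close>.\<close>

definition prod_adjoint ::
  "(('a::real_normed_vector \<times> 'b::real_normed_vector) \<Rightarrow>\<^sub>L 'y::real_inner) \<Rightarrow> 'y \<Rightarrow>
    ('a \<Rightarrow>\<^sub>L real) \<times> ('b \<Rightarrow>\<^sub>L real)" where
  "prod_adjoint L \<omega> = (Blinfun (\<lambda>a. \<omega> \<bullet> L (a, 0)), Blinfun (\<lambda>b. \<omega> \<bullet> L (0, b)))"

lemma prod_adjoint_apply:
  "fst (prod_adjoint L \<omega>) a + snd (prod_adjoint L \<omega>) b = \<omega> \<bullet> L (a, b)"
proof -
  have "bounded_linear (\<lambda>a. \<omega> \<bullet> L (a, 0))" "bounded_linear (\<lambda>b. \<omega> \<bullet> L (0, b))"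
    by (intro bounded_linear_intros)+
  then show ?thesis
    by (simp add: prod_adjoint_def bounded_linear_Blinfun_apply
        flip: inner_add_right blinfun.add_right)
qed


section \<open>Diconvex functionals\<close>

definition proper_functional :: "('a \<Rightarrow> ereal) \<Rightarrow> bool" where
  "proper_functional F \<longleftrightarrow> (\<forall>x. F x \<noteq> -\<infinity>) \<and> (\<exists>x. F x \<noteq> \<infinity>)"

text \<open>Used for proper functionals only, so that no sum \<open>\<infinity> + (-\<infinity>)\<close> occurs.\<close>

definition convex_functional :: "('a::real_vector \<Rightarrow> ereal) \<Rightarrow> bool" where
  "convex_functional F \<longleftrightarrow>
    (\<forall>x y t. 0 < t \<and> t < 1 \<longrightarrow>
      F (t *\<^sub>R x + (1 - t) *\<^sub>R y) \<le> ereal t * F x + ereal (1 - t) * F y)"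

definition diconvex :: "('x::real_normed_vector \<Rightarrow> ereal) \<Rightarrow> bool" where
  "diconvex F \<longleftrightarrow>
    (\<exists>G :: 'x \<times> 'x sym_tensor \<Rightarrow> ereal. proper_functional G \<and> convex_functional G \<and>
      (\<forall>u. F u = G (u, tensor_square u)))"

definition dilinear_subdifferential ::
  "('x::real_normed_vector \<Rightarrow> ereal) \<Rightarrow> 'x \<Rightarrow> (('x \<Rightarrow>\<^sub>L real) \<times> ('x sym_tensor \<Rightarrow>\<^sub>L real)) set" where
  "dilinear_subdifferential F u =
    {(\<xi> :: 'x \<Rightarrow>\<^sub>L real, \<Xi> :: 'x sym_tensor \<Rightarrow>\<^sub>L real). \<bar>F u\<bar> \<noteq> \<infinity> \<and>
      (\<forall>v. F v \<ge> F u + ereal (\<xi> (v - u)) + ereal (\<Xi> (tensor_square v - tensor_square u)))}"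

text \<open>Meaningful for \<open>(\<xi>, \<Xi>)\<close> in the dilinear subdifferential of \<open>F\<close> at \<open>u\<close>, where \<open>F u\<close> is
  finite; \<open>F v\<close> may be \<open>\<infinity>\<close>.\<close>

definition dilinear_bregman ::
  "('x::real_normed_vector \<Rightarrow> ereal) \<Rightarrow> ('x \<Rightarrow>\<^sub>L real) \<times> ('x sym_tensor \<Rightarrow>\<^sub>L real) \<Rightarrow>
    'x \<Rightarrow> 'x \<Rightarrow> ereal" where
  "dilinear_bregman F = (\<lambda>(\<xi> :: 'x \<Rightarrow>\<^sub>L real, \<Xi> :: 'x sym_tensor \<Rightarrow>\<^sub>L real) v u.
    F v - F u - ereal (\<xi> (v - u)) - ereal (\<Xi> (tensor_square v - tensor_square u)))"


section \<open>Tikhonov regularization\<close>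

definition minimizing_solution ::
  "('x \<Rightarrow> ereal) \<Rightarrow> ('x \<Rightarrow> 'y) \<Rightarrow> 'y \<Rightarrow> 'x \<Rightarrow> bool" where
  "minimizing_solution R K g u \<longleftrightarrow> K u = g \<and> (\<forall>v. K v = g \<longrightarrow> R u \<le> R v)"

definition tikhonov ::
  "('x \<Rightarrow> 'y::real_normed_vector) \<Rightarrow> ('x \<Rightarrow> ereal) \<Rightarrow> real \<Rightarrow> 'y \<Rightarrow> 'x \<Rightarrow> ereal" where
  "tikhonov K R \<alpha> g u = ereal ((norm (K u - g))\<^sup>2) + ereal \<alpha> * R u"

end

theory Submission
  imports Defs
begin

text \<open>Write \<open>a = K u - g\<^sub>\<delta>\<close> and \<open>b = g\<^sub>0 - g\<^sub>\<delta>\<close>. The source condition turns the Bregman distance \<open>D\<close>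
  into \<open>R u - R u\<^sub>0 - \<langle>\<omega>, a - b\<rangle>\<close>, so comparing the minimizer with \<open>u\<^sub>0\<close> and completing the square gives
  \<open>\<parallel>a + \<alpha>\<omega>/2\<parallel>\<^sup>2 + \<alpha> D \<le> \<parallel>b + \<alpha>\<omega>/2\<parallel>\<^sup>2 \<le> (\<delta> + \<alpha>\<parallel>\<omega>\<parallel>/2)\<^sup>2\<close>. Since \<open>D \<ge> 0\<close>, both estimates follow.\<close>

text \<open>\<open>K\<close> is nonlinear, but its lifting is linear in the pair
  \<open>(v, tensor_square v)\<close>, so the adjoint can be moved across differences of such pairs.
  This rewrites the linear terms of the Bregman distance through \<open>K\<close>.\<close>

lemma prod_adjoint_bounded_lifting_diff:
  assumes "bounded_lifting K L" and "prod_adjoint L \<omega> = (\<xi>, \<Xi>)"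
  shows "\<xi> (v - u) + \<Xi> (tensor_square v - tensor_square u) = \<omega> \<bullet> (K v - K u)"
  using prod_adjoint_apply[of L \<omega> "v - u" "tensor_square v - tensor_square u"] assms
  by (simp add: bounded_lifting_def flip: blinfun.diff_right)

text \<open>The Hilbert space core, free of \<open>K\<close> and \<open>R\<close>. Shifting by
  \<open>c\<close> absorbs the linear terms; dropping one of the two non-negative summands in
  \<open>sq\<close> then leaves one estimate each.\<close>

lemma perturbed_square_estimates:
  fixes a b \<omega> :: "'y::real_inner" and D \<alpha> \<delta> :: real
  assumes "0 \<le> D" and "0 < \<alpha>" and b: "norm b \<le> \<delta>"
    and le: "(norm a)\<^sup>2 + \<alpha> * (D + \<omega> \<bullet> (a - b)) \<le> (norm b)\<^sup>2"
  shows "D \<le> (\<delta> / sqrt \<alpha> + sqrt \<alpha> / 2 * norm \<omega>)\<^sup>2" and "norm a \<le> \<delta> + \<alpha> * norm \<omega>"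
proof -
  \<comment> \<open>The factor 1/2 turns the cross term \<open>2 * (x \<bullet> c)\<close> into
    \<open>\<alpha> * (\<omega> \<bullet> x)\<close>.\<close>
  define c where "c = (\<alpha> / 2) *\<^sub>R \<omega>"
  define m where "m = \<delta> + \<alpha> / 2 * norm \<omega>"
  have c: "norm c = \<alpha> / 2 * norm \<omega>" using \<open>0 < \<alpha>\<close> by (simp add: c_def)
  have "0 \<le> \<delta>" using b norm_ge_zero order_trans by blast
  then have "0 \<le> m" using \<open>0 < \<alpha>\<close> by (simp add: m_def)
  have "norm (b + c) \<le> m"
    using norm_triangle_ineq[of b c] b c by (simp add: m_def)
  then have "(norm (b + c))\<^sup>2 \<le> m\<^sup>2" by (simp add: power_mono)
  \<comment> \<open>Used for \<open>x = a\<close> and \<open>x = b\<close>, so that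
    \<open>(norm c)\<^sup>2\<close> cancels.\<close>
  moreover have "(norm (x + c))\<^sup>2 = (norm x)\<^sup>2 + \<alpha> * (\<omega> \<bullet> x) + (norm c)\<^sup>2" for x
    using dot_norm[of x c] by (simp add: c_def inner_commute[of \<omega>] del: norm_scaleR)
  ultimately have sq: "(norm (a + c))\<^sup>2 + \<alpha> * D \<le> m\<^sup>2"
    using le by (simp add: inner_diff_right algebra_simps)
  have "\<delta> / sqrt \<alpha> + sqrt \<alpha> / 2 * norm \<omega> = m / sqrt \<alpha>"
    using \<open>0 < \<alpha>\<close> by (simp add: m_def field_simps)
  then have "(\<delta> / sqrt \<alpha> + sqrt \<alpha> / 2 * norm \<omega>)\<^sup>2 = m\<^sup>2 / \<alpha>"
    using \<open>0 < \<alpha>\<close> by (simp add: power_divide)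
  moreover have "\<alpha> * D \<le> m\<^sup>2" using sq zero_le_power2[of "norm (a + c)"] by linarith
  ultimately show "D \<le> (\<delta> / sqrt \<alpha> + sqrt \<alpha> / 2 * norm \<omega>)\<^sup>2"
    using \<open>0 < \<alpha>\<close> by (simp add: pos_le_divide_eq mult.commute)
  have "(norm (a + c))\<^sup>2 \<le> m\<^sup>2"
    using sq mult_nonneg_nonneg[of \<alpha> D] \<open>0 < \<alpha>\<close> \<open>0 \<le> D\<close> by linarith
  then have "norm (a + c) \<le> m" using \<open>0 \<le> m\<close> by (rule power2_le_imp_le)
  \<comment> \<open>Undoing the shift costs \<open>norm c\<close>, the second half of
    \<open>\<alpha> * norm \<omega>\<close>; the first half is in \<open>m\<close>.\<close>
  then show "norm a \<le> \<delta> + \<alpha> * norm \<omega>"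
    using norm_triangle_ineq4[of "a + c" c] c by (simp add: m_def)
qed

theorem theorem4p16:
  fixes \<iota> :: "'x::banach \<Rightarrow> ('p::banach \<Rightarrow>\<^sub>L real)"
    and K :: "'x \<Rightarrow> 'y::{real_inner, banach}"
    and L :: "('x \<times> 'x sym_tensor) \<Rightarrow>\<^sub>L 'y"
    and R :: "'x \<Rightarrow> ereal"
    and g\<^sub>0 g\<^sub>\<delta> \<omega> :: 'y
    and \<delta> \<alpha> :: real
    and u\<^sub>0 :: 'x
    and \<xi> :: "'x \<Rightarrow>\<^sub>L real"
    and \<Xi> :: "'x sym_tensor \<Rightarrow>\<^sub>L real"
  assumes "is_predual \<iota>"
    and "separable_space (euclidean :: 'p topology) \<or> reflexive_space TYPE('p)"
    and "bounded_dilinear K" and "bounded_lifting K L"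
    and "\<forall>u. 0 \<le> R u" and "proper_functional R" and "diconvex R"
    and "norm (g\<^sub>0 - g\<^sub>\<delta>) \<le> \<delta>" and "\<alpha> > 0"
    and "(tikhonov K R \<alpha> g\<^sub>\<delta> \<longlongrightarrow> \<infinity>) at_infinity"
    and "seq_weakstar_lsc \<iota> R"
    and "seq_weakstar_continuous \<iota> (blinfun_inner_right :: 'y \<Rightarrow> ('y \<Rightarrow>\<^sub>L real)) K"
    and "minimizing_solution R K g\<^sub>0 u\<^sub>0"
    and "prod_adjoint L \<omega> = (\<xi>, \<Xi>)" and "(\<xi>, \<Xi>) \<in> dilinear_subdifferential R u\<^sub>0"
  shows "\<forall>u. (\<forall>v. tikhonov K R \<alpha> g\<^sub>\<delta> u \<le> tikhonov K R \<alpha> g\<^sub>\<delta> v) \<longrightarrow>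
    dilinear_bregman R (\<xi>, \<Xi>) u u\<^sub>0 \<le> ereal ((\<delta> / sqrt \<alpha> + sqrt \<alpha> / 2 * norm \<omega>)\<^sup>2) \<and>
    norm (K u - g\<^sub>\<delta>) \<le> \<delta> + \<alpha> * norm \<omega>"
proof (intro allI impI)
  fix u assume min: "\<forall>v. tikhonov K R \<alpha> g\<^sub>\<delta> u \<le> tikhonov K R \<alpha> g\<^sub>\<delta> v"
  have K\<^sub>0: "K u\<^sub>0 = g\<^sub>0" using assms(13) by (simp add: minimizing_solution_def)
  have subdiff: "\<bar>R u\<^sub>0\<bar> \<noteq> \<infinity>"
    "R u \<ge> R u\<^sub>0 + ereal (\<xi> (u - u\<^sub>0)) + ereal (\<Xi> (tensor_square u - tensor_square u\<^sub>0))"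
    using assms(15) by (auto simp: dilinear_subdifferential_def)
  obtain r\<^sub>0 where r\<^sub>0: "R u\<^sub>0 = ereal r\<^sub>0" using subdiff(1) by (cases "R u\<^sub>0") auto
  have le: "tikhonov K R \<alpha> g\<^sub>\<delta> u \<le> tikhonov K R \<alpha> g\<^sub>\<delta> u\<^sub>0" using min by blast
  \<comment> \<open>The Tikhonov value at \<open>u\<^sub>0\<close> is finite and bounds the one at
    \<open>u\<close>; from here on the argument is in real numbers.\<close>
  have "R u \<noteq> \<infinity>" using le \<open>\<alpha> > 0\<close> by (auto simp: tikhonov_def r\<^sub>0)
  moreover have "0 \<le> R u" using assms(5) by blast
  ultimately obtain r where r: "R u = ereal r" by (cases "R u") auto
  define D where "D = r - r\<^sub>0 - \<omega> \<bullet> (K u - K u\<^sub>0)"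
  note pairing = prod_adjoint_bounded_lifting_diff[OF assms(4,14), of u u\<^sub>0]
  have bregman: "dilinear_bregman R (\<xi>, \<Xi>) u u\<^sub>0 = ereal D"
    using pairing by (simp add: dilinear_bregman_def r r\<^sub>0 D_def)
  \<comment> \<open>The subgradient inequality at \<open>u\<^sub>0\<close>, tested with the
    minimizer.\<close>
  have "0 \<le> D" using subdiff(2) pairing by (simp add: r r\<^sub>0 D_def)
  \<comment> \<open>The comparison \<open>le\<close> with \<open>r - r\<^sub>0\<close> replaced by
    \<open>D + \<omega> \<bullet> (K u - g\<^sub>0)\<close>, the second factor written as a
    difference of residuals.\<close>
  moreover have "(norm (K u - g\<^sub>\<delta>))\<^sup>2 + \<alpha> * (D + \<omega> \<bullet> ((K u - g\<^sub>\<delta>) - (g\<^sub>0 - g\<^sub>\<delta>)))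
      \<le> (norm (g\<^sub>0 - g\<^sub>\<delta>))\<^sup>2"
    using le by (simp add: tikhonov_def r r\<^sub>0 K\<^sub>0 D_def right_diff_distrib)
  ultimately show "dilinear_bregman R (\<xi>, \<Xi>) u u\<^sub>0
        \<le> ereal ((\<delta> / sqrt \<alpha> + sqrt \<alpha> / 2 * norm \<omega>)\<^sup>2) \<and>
      norm (K u - g\<^sub>\<delta>) \<le> \<delta> + \<alpha> * norm \<omega>"
    using perturbed_square_estimates[of D \<alpha> "g\<^sub>0 - g\<^sub>\<delta>" \<delta> "K u - g\<^sub>\<delta>" \<omega>] assms(8,9)
    by (simp add: bregman)
qed

end
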